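(* Let $f:\mathbb{R}^d\to\mathbb{R}$ be glocally $(L,L_*,\delta)$-smooth and $\mu$-strongly convex with $\mu>0$, with minimizer $w_*$ and $f_*=f(w_* )$. Let $w_0\in\mathbb{R}^d$, $\Delta_0=f(w_0)-f_*$, and let $\epsilon$ satisfy $\Delta_0>\delta>\epsilon>0$. Let $(w_t)$ be the iterates of Nesterov's accelerated gradient method with step size $\eta_t$ given by backtracking from some $\eta_{\max}\ge1/L_*$ by dividing the step size in half until the two-step Armijo condition holds (method and condition defined in the context). Then $f(w_T)-f_*\le\epsilon$ for all integers $T$ with $$T\ge\sqrt{\frac{2L}{\mu}}\log\left(\frac{L}{\mu}\,\frac{\Delta_0+\frac{\mu}{2}\|w_0-w_*\|^2}{\delta}\right)+\sqrt{\frac{2L_*}{\mu}}\log\left(\frac{\mu}{L}\frac{\delta}{\epsilon}\right)+1.$$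
   Context: $\|\cdot\|$ is the Euclidean norm, functions are differentiable, and $L,L_*,\delta>0$. Glocal smoothness: $f$ with infimum $f_*$ is glocally $(L,L_*,\delta)$-smooth if (i) $\|\nabla f(u)-\nabla f(v)\|\le L\|u-v\|$ for all $u,v\in\mathbb{R}^d$, and (ii) $\|\nabla f(u)-\nabla f(v)\|\le L_*\|u-v\|$ for all $u,v$ in the set $\{u: f(u)-f_*\le\delta\}$. Strong convexity: $f$ is $\mu$-strongly convex if $f(v)\ge f(u)+\langle\nabla f(u),v-u\rangle+\frac{\mu}{2}\|v-u\|^2$ for all $u,v\in\mathbb{R}^d$. Method: $z_0=w_0$ and, with $q_t=\eta_t\mu$, for $t\ge0$ $$y_t=w_t+\frac{\sqrt{q_t}}{1+\sqrt{q_t}}(z_t-w_t),\quad w_{t+1}=y_t-\eta_t\nabla f(y_t),\quad z_{t+1}=(1-\sqrt{q_t})z_t+\sqrt{q_t}\left(y_t-\frac1\mu\nabla f(y_t)\right).$$ Two-step Armijo condition: for a candidate $\eta$, both $y_t$ and $w_{t+1}$ are recomputed with $\eta_t=\eta$ (the search is performed through the computation of $y_t$, rather than just on $w_t$), and the condition is $f(w_{t+1})\le f(y_t)-\frac{\eta}{2}\|\nabla f(y_t)\|^2$. The search starts from $\eta_{\max}$ at each iteration.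
   Formalization: Assumes in addition L_* ≤ L; otherwise the second logarithm term can make the bound negative and the claim false (f(x)=x²/2, μ=1, L=2, L_*=100, δ=1, ε=0.9, w_0=2 would allow T=0). *)

theory Defs
  imports "HOL-Analysis.Analysis"
begin

definition grad :: "('a::real_inner \<Rightarrow> real) \<Rightarrow> 'a \<Rightarrow> 'a" where
  "grad f x = (THE g. GDERIV f x :> g)"

lemma GDERIV_grad:
  fixes f :: "'a::euclidean_space \<Rightarrow> real"
  assumes "f differentiable (at x)"
  shows "GDERIV f x :> grad f x"
proof -
  obtain D where D: "(f has_derivative D) (at x)"
    using assms unfolding differentiable_def by blast
  then interpret bounded_linear D by (rule has_derivative_bounded_linear)
  define g where "g = (\<Sum>b\<in>Basis. D b *\<^sub>R b)"
  have "D h = h \<bullet> g" for h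
  proof -
    have "D h = D (\<Sum>b\<in>Basis. (h \<bullet> b) *\<^sub>R b)" by (simp add: euclidean_representation)
    also have "\<dots> = (\<Sum>b\<in>Basis. (h \<bullet> b) * D b)" by (simp add: sum scaleR)
    also have "\<dots> = h \<bullet> g"
      unfolding g_def by (simp add: inner_sum_right mult.commute)
    finally show ?thesis .
  qed
  then have "D = (\<lambda>h. h \<bullet> g)" by blast
  with D have g: "GDERIV f x :> g" by (simp add: gderiv_def)
  have "g' = g" if "GDERIV f x :> g'" for g'
  proof -
    have "(\<lambda>h. h \<bullet> g') = (\<lambda>h. h \<bullet> g)"
      using that g unfolding gderiv_def by (rule has_derivative_unique)
    then have "(g' - g) \<bullet> g' = (g' - g) \<bullet> g" by (rule fun_cong)
    then have "(g' - g) \<bullet> (g' - g) = 0" by (simp add: inner_diff_right)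
    then show ?thesis by simp
  qed
  with g show ?thesis unfolding grad_def by (rule theI)
qed

text \<open>The infimum of \<open>f\<close> is \<open>Inf (range f)\<close>. On the reals this value is meaningful only if
  \<open>f\<close> is bounded below, so boundedness is part of the definition.\<close>

definition glocally_smooth :: "real \<Rightarrow> real \<Rightarrow> real \<Rightarrow> ('a::real_inner \<Rightarrow> real) \<Rightarrow> bool" where
  "glocally_smooth L Ls \<delta> f \<longleftrightarrow>
     bdd_below (range f) \<and>
     (\<forall>u v. norm (grad f u - grad f v) \<le> L * norm (u - v)) \<and>
     (\<forall>u\<in>{x. f x - Inf (range f) \<le> \<delta>}. \<forall>v\<in>{x. f x - Inf (range f) \<le> \<delta>}.
        norm (grad f u - grad f v) \<le> Ls * norm (u - v))"

definition strongly_convex :: "real \<Rightarrow> ('a::real_inner \<Rightarrow> real) \<Rightarrow> bool" where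
  "strongly_convex \<mu> f \<longleftrightarrow>
     (\<forall>u v. f v \<ge> f u + grad f u \<bullet> (v - u) + \<mu> / 2 * (norm (v - u))\<^sup>2)"

text \<open>One step of the method, as functions of the step size \<open>\<eta>\<close> and the current pair
  \<open>(w, z)\<close>; throughout \<open>q = \<eta> * \<mu>\<close>.\<close>

definition nag_y :: "real \<Rightarrow> real \<Rightarrow> 'a \<Rightarrow> 'a \<Rightarrow> 'a::real_inner" where
  "nag_y \<mu> \<eta> w z = w + (sqrt (\<eta> * \<mu>) / (1 + sqrt (\<eta> * \<mu>))) *\<^sub>R (z - w)"

definition nag_w :: "('a::real_inner \<Rightarrow> real) \<Rightarrow> real \<Rightarrow> real \<Rightarrow> 'a \<Rightarrow> 'a \<Rightarrow> 'a" where
  "nag_w f \<mu> \<eta> w z = (let y = nag_y \<mu> \<eta> w z in y - \<eta> *\<^sub>R grad f y)"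

definition nag_z :: "('a::real_inner \<Rightarrow> real) \<Rightarrow> real \<Rightarrow> real \<Rightarrow> 'a \<Rightarrow> 'a \<Rightarrow> 'a" where
  "nag_z f \<mu> \<eta> w z = (let y = nag_y \<mu> \<eta> w z in
     (1 - sqrt (\<eta> * \<mu>)) *\<^sub>R z + sqrt (\<eta> * \<mu>) *\<^sub>R (y - (1 / \<mu>) *\<^sub>R grad f y))"

definition two_step_armijo ::
  "('a::real_inner \<Rightarrow> real) \<Rightarrow> real \<Rightarrow> real \<Rightarrow> 'a \<Rightarrow> 'a \<Rightarrow> bool" where
  "two_step_armijo f \<mu> \<eta> w z \<longleftrightarrow>
     f (nag_w f \<mu> \<eta> w z) \<le>
       f (nag_y \<mu> \<eta> w z) - \<eta> / 2 * (norm (grad f (nag_y \<mu> \<eta> w z)))\<^sup>2"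

text \<open>The first accepted value in the sequence \<open>\<eta>max, \<eta>max/2, \<eta>max/4, \<dots>\<close>. If no
  candidate were accepted, \<open>LEAST\<close> would be unspecified; termination of the search
  is not assumed anywhere.\<close>

definition backtracking_step ::
  "('a::real_inner \<Rightarrow> real) \<Rightarrow> real \<Rightarrow> real \<Rightarrow> 'a \<Rightarrow> 'a \<Rightarrow> real" where
  "backtracking_step f \<mu> \<eta>max w z =
     \<eta>max / 2 ^ (LEAST k::nat. two_step_armijo f \<mu> (\<eta>max / 2 ^ k) w z)"

text \<open>\<open>nag f \<mu> \<eta>max w0 t\<close> is the pair \<open>(w\<^sub>t, z\<^sub>t)\<close>.\<close>

primrec nag :: "('a::real_inner \<Rightarrow> real) \<Rightarrow> real \<Rightarrow> real \<Rightarrow> 'a \<Rightarrow> nat \<Rightarrow> 'a \<times> 'a" where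
  "nag f \<mu> \<eta>max w0 0 = (w0, w0)"
| "nag f \<mu> \<eta>max w0 (Suc t) =
     (let (w, z) = nag f \<mu> \<eta>max w0 t;
          \<eta> = backtracking_step f \<mu> \<eta>max w z
      in (nag_w f \<mu> \<eta> w z, nag_z f \<mu> \<eta> w z))"

end

theory Submission
  imports Defs
begin

text \<open>
  The proof follows the potential
  \<open>V = f w - f wstar + \<mu>/2 * \<parallel>z - wstar\<parallel>\<^sup>2\<close>. Write \<open>s = sqrt (\<eta> * \<mu>)\<close> for an accepted
  step size \<open>\<eta>\<close>. If \<open>s \<le> 1\<close>, the Armijo inequality and two uses of strong convexity, from \<open>y\<close>
  to \<open>w\<close> and from \<open>y\<close> to \<open>wstar\<close>, give \<open>V' \<le> (1 - s) * V\<close> (\<open>lyapunov_step\<close>). The step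
  size of the preceding iteration does not enter, so the search may restart freely.

  Backtracking halves a candidate only if it is rejected. Hence, if every \<open>\<eta> \<le> 1 / \<Lambda>\<close> is
  acceptable, the chosen step is at least \<open>1 / (2 * \<Lambda>)\<close> and \<open>V\<close> contracts by
  \<open>exp (- sqrt (\<mu> / (2 * \<Lambda>)))\<close>. Globally one can take \<open>\<Lambda> = L\<close>. Once \<open>V \<le> \<mu> * \<delta> / L\<close>, both
  \<open>w\<close> and \<open>z\<close> lie in the sublevel set \<open>f \<le> f wstar + \<delta>\<close>; being convex, this set contains the
  point \<open>y\<close> of every candidate, and \<open>\<Lambda> = Ls\<close> becomes possible
  (\<open>armijo_of_lipschitz_sublevel\<close>, \<open>nag_y_in_sublevel\<close>). The two logarithmic terms in the bound are
  the lengths of these two phases, and the additional iteration pays for rounding the length of the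
  first phase to an integer.

  One case needs extra care. A step with \<open>s > 1\<close> is accepted exactly when \<open>y\<close> happens to equal
  \<open>wstar\<close>, because the gradient vanishes there and the Armijo condition is void. Such a step may fail
  to contract \<open>V\<close> at the desired rate: it puts \<open>w\<close> at the minimizer but can leave \<open>z\<close> far away. It
  does not increase \<open>V\<close>, however (\<open>lyapunov_long_step\<close>), and a step that starts with
  \<open>w = wstar\<close> contracts by \<open>exp (- 2 * s)\<close>, the equivalent of two steps
  (\<open>lyapunov_step_from_minimizer\<close>). So \<open>V\<close> lags by at most one contraction factor, and only
  at times when \<open>f w = f wstar\<close>; this is the invariant \<open>envelope\<close>.
\<close>

section \<open>Two elementary exponential estimates\<close>

text \<open>Equivalent to \<open>s \<le> artanh s\<close> for \<open>s < 1\<close>. It shows that the factor obtained from a step starting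
  at the minimizer is as good as two ordinary contractions.\<close>
lemma exp_contraction_double:
  fixes s :: real
  assumes "0 \<le> s"
  shows "(1 - s) / (1 + s) \<le> exp (- (2 * s))"
proof -
  define h :: "real \<Rightarrow> real" where "h x = (1 + x) * exp (- x) - (1 - x) * exp x" for x
  have deriv: "(h has_real_derivative x * (exp x - exp (- x))) (at x)" for x
    unfolding h_def by (auto intro!: derivative_eq_intros simp: algebra_simps)
  have "h 0 \<le> h s"
  proof (rule DERIV_nonneg_imp_nondecreasing[OF assms])
    fix x :: real assume "0 \<le> x"
    then have "0 \<le> x * (exp x - exp (- x))" by simp
    with deriv show "\<exists>y. (h has_real_derivative y) (at x) \<and> 0 \<le> y" by blast
  qed
  then have "(1 - s) * exp s \<le> (1 + s) * exp (- s)" by (simp add: h_def)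
  then have "(1 - s) * exp s * exp (- s) \<le> (1 + s) * exp (- s) * exp (- s)"
    by (intro mult_right_mono) auto
  moreover have "(1 - s) * exp s * exp (- s) = 1 - s" by (simp add: exp_minus)
  moreover have "(1 + s) * exp (- s) * exp (- s) = (1 + s) * exp (- (2 * s))"
    by (simp add: mult.assoc flip: exp_add)
  ultimately have "1 - s \<le> (1 + s) * exp (- (2 * s))" by linarith
  then show ?thesis using assms by (simp add: divide_le_eq mult.commute)
qed

lemma exp_decay_le:
  fixes \<rho> :: real
  assumes "0 < \<rho>" "0 < A" "0 < B" "1 / \<rho> * ln (A / B) \<le> t"
  shows "exp (- (t * \<rho>)) * A \<le> B"
proof -
  have "ln (A / B) \<le> t * \<rho>" using assms by (simp add: field_simps)
  then have "exp (ln (A / B)) \<le> exp (t * \<rho>)" by simp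
  then have "A / B \<le> exp (t * \<rho>)" using assms by simp
  then show ?thesis using assms by (simp add: exp_minus field_simps)
qed

section \<open>Backtracking\<close>

lemma backtracking_accepts:
  assumes small: "\<And>\<eta>. 0 < \<eta> \<Longrightarrow> \<eta> \<le> 1 / \<Lambda> \<Longrightarrow> two_step_armijo f \<mu> \<eta> w z"
    and "0 < \<Lambda>" and start: "1 / \<Lambda> \<le> \<eta>max"
  shows "two_step_armijo f \<mu> (backtracking_step f \<mu> \<eta>max w z) w z"
    and "1 / (2 * \<Lambda>) \<le> backtracking_step f \<mu> \<eta>max w z"
proof -
  define P where "P k \<longleftrightarrow> two_step_armijo f \<mu> (\<eta>max / 2 ^ k) w z" for k :: nat
  have "0 < 1 / \<Lambda>" using \<open>0 < \<Lambda>\<close> by simp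
  with start have pos: "0 < 1 / \<Lambda>" "0 < \<eta>max" by linarith+
  obtain k :: nat where "\<eta>max * \<Lambda> < 2 ^ k" using real_arch_pow[of 2 "\<eta>max * \<Lambda>"] by auto
  then have "\<eta>max / 2 ^ k \<le> 1 / \<Lambda>" using \<open>0 < \<Lambda>\<close> by (simp add: field_simps)
  then have "P k" unfolding P_def using pos by (intro small) auto
  then have "P (LEAST k. P k)" by (rule LeastI)
  then show "two_step_armijo f \<mu> (backtracking_step f \<mu> \<eta>max w z) w z"
    by (simp add: backtracking_step_def P_def)
  have "1 / (2 * \<Lambda>) \<le> \<eta>max / 2 ^ (LEAST k. P k)"
  proof (cases "LEAST k. P k")
    case 0
    then show ?thesis using start pos \<open>0 < \<Lambda>\<close> by (simp add: field_simps)
  next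
    case (Suc j)
    then have "\<not> P j" by (metis lessI not_less_Least)
    then have "1 / \<Lambda> < \<eta>max / 2 ^ j" unfolding P_def using small[of "\<eta>max / 2 ^ j"] pos by force
    then show ?thesis using Suc by simp
  qed
  then show "1 / (2 * \<Lambda>) \<le> backtracking_step f \<mu> \<eta>max w z"
    by (simp add: backtracking_step_def P_def)
qed

section \<open>Smooth strongly convex functions\<close>

locale smooth_strongly_convex =
  fixes f :: "'a::euclidean_space \<Rightarrow> real" and L \<mu> :: real and wstar :: 'a
  assumes differentiable: "f differentiable (at u)"
    and L_pos: "0 < L" and mu_pos: "0 < \<mu>"
    and lipschitz: "norm (grad f u - grad f v) \<le> L * norm (u - v)"
    and convex: "strongly_convex \<mu> f"
    and minimizer: "f wstar \<le> f u"
begin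

lemma strong_convexity: "f u + grad f u \<bullet> (v - u) + \<mu> / 2 * (norm (v - u))\<^sup>2 \<le> f v"
  using convex unfolding strongly_convex_def by blast

lemma derivative_along_line:
  "((\<lambda>t. f (u + t *\<^sub>R d)) has_real_derivative grad f (u + t *\<^sub>R d) \<bullet> d) (at t)"
proof -
  have "(f has_derivative (\<lambda>h. h \<bullet> grad f (u + t *\<^sub>R d))) (at (u + t *\<^sub>R d))"
    using GDERIV_grad[OF differentiable] unfolding gderiv_def .
  moreover have "((\<lambda>t. u + t *\<^sub>R d) has_derivative (\<lambda>h. h *\<^sub>R d)) (at t)"
    by (auto intro!: derivative_eq_intros)
  ultimately have "((\<lambda>t. f (u + t *\<^sub>R d)) has_derivative
      (\<lambda>h. (h *\<^sub>R d) \<bullet> grad f (u + t *\<^sub>R d))) (at t)"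
    by (rule has_derivative_compose[rotated])
  then show ?thesis
    by (rule has_derivative_imp_has_field_derivative) (simp add: inner_commute)
qed

text \<open>The Lipschitz bound is asked for on the segment only, and only relative to its starting point, so
  that the lemma serves both the global constant and the one valid on a sublevel set.\<close>
lemma descent_lemma:
  assumes lip: "\<And>t. 0 \<le> t \<Longrightarrow> t \<le> 1 \<Longrightarrow>
      norm (grad f (u + t *\<^sub>R d) - grad f u) \<le> \<Lambda> * norm (t *\<^sub>R d)"
  shows "f (u + d) \<le> f u + grad f u \<bullet> d + \<Lambda> / 2 * (norm d)\<^sup>2"
proof -
  define h where "h t = f (u + t *\<^sub>R d) - t * (grad f u \<bullet> d) - \<Lambda> / 2 * t\<^sup>2 * (norm d)\<^sup>2" for t
  have deriv: "(h has_real_derivative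
      grad f (u + t *\<^sub>R d) \<bullet> d - grad f u \<bullet> d - \<Lambda> * t * (norm d)\<^sup>2) (at t)" for t
    unfolding h_def by (auto intro!: derivative_eq_intros derivative_along_line)
  have "h 1 \<le> h 0"
  proof (rule DERIV_nonpos_imp_nonincreasing[of 0 1 h])
    fix t :: real assume t: "0 \<le> t" "t \<le> 1"
    have "(grad f (u + t *\<^sub>R d) - grad f u) \<bullet> d \<le> norm (grad f (u + t *\<^sub>R d) - grad f u) * norm d"
      by (rule norm_cauchy_schwarz)
    also have "\<dots> \<le> \<Lambda> * norm (t *\<^sub>R d) * norm d"
      by (intro mult_right_mono lip t) auto
    also have "\<dots> = \<Lambda> * t * (norm d)\<^sup>2" using t by (simp add: power2_eq_square)
    finally show "\<exists>y. (h has_real_derivative y) (at t) \<and> y \<le> 0"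
      using deriv by (intro exI conjI) (auto simp: inner_diff_left)
  qed auto
  then show ?thesis by (simp add: h_def)
qed

lemma smooth_upper_bound: "f (u + d) \<le> f u + grad f u \<bullet> d + L / 2 * (norm d)\<^sup>2"
  by (rule descent_lemma) (use lipschitz in \<open>metis add_diff_cancel_left'\<close>)

lemma grad_minimizer: "grad f wstar = 0"
proof -
  let ?g = "grad f wstar"
  have "f wstar \<le> f (wstar + (- (1 / L)) *\<^sub>R ?g)" by (rule minimizer)
  also have "\<dots> \<le> f wstar + ?g \<bullet> ((- (1 / L)) *\<^sub>R ?g) + L / 2 * (norm ((- (1 / L)) *\<^sub>R ?g))\<^sup>2"
    by (rule smooth_upper_bound)
  also have "\<dots> = f wstar - (norm ?g)\<^sup>2 / (2 * L)"
    unfolding power2_norm_eq_inner using L_pos by (simp add: field_simps)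
  finally show ?thesis using L_pos by (simp add: divide_le_0_iff)
qed

lemma growth_lower: "\<mu> / 2 * (norm (u - wstar))\<^sup>2 \<le> f u - f wstar"
  using strong_convexity[of wstar u] by (simp add: grad_minimizer)

lemma growth_upper: "f u - f wstar \<le> L / 2 * (norm (u - wstar))\<^sup>2"
  using smooth_upper_bound[of wstar "u - wstar"] by (simp add: grad_minimizer)

lemma critical_point_unique:
  assumes "grad f u = 0"
  shows "u = wstar"
proof -
  have "\<mu> / 2 * (norm (wstar - u))\<^sup>2 \<le> 0"
    using strong_convexity[of u wstar] minimizer[of u] assms by simp
  then show ?thesis using mu_pos by (simp add: mult_le_0_iff)
qed

text \<open>Sublevel sets of \<open>f\<close> are convex, in the form in which segments occur below.\<close>
lemma between_convex:
  assumes "0 \<le> t" "t \<le> 1" "f u \<le> c" "f (u + d) \<le> c"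
  shows "f (u + t *\<^sub>R d) \<le> c"
proof -
  let ?p = "u + t *\<^sub>R d"
  have 1: "f ?p - t * (grad f ?p \<bullet> d) \<le> f u"
  proof -
    have "0 \<le> \<mu> / 2 * (norm (u - ?p))\<^sup>2" using mu_pos by simp
    then show ?thesis using strong_convexity[of ?p u] by (simp add: inner_simps)
  qed
  have eq: "u + d - ?p = (1 - t) *\<^sub>R d" by (simp add: algebra_simps)
  have 2: "f ?p + (1 - t) * (grad f ?p \<bullet> d) \<le> f (u + d)"
  proof -
    have "0 \<le> \<mu> / 2 * (norm ((1 - t) *\<^sub>R d))\<^sup>2" using mu_pos by simp
    then show ?thesis using strong_convexity[of ?p "u + d"] unfolding eq inner_scaleR_right by linarith
  qed
  have "(1 - t) * (f ?p - t * (grad f ?p \<bullet> d)) \<le> (1 - t) * c"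
    "t * (f ?p + (1 - t) * (grad f ?p \<bullet> d)) \<le> t * c"
    using 1 2 assms by (auto intro!: mult_left_mono)
  then have "(1 - t) * (f ?p - t * (grad f ?p \<bullet> d)) + t * (f ?p + (1 - t) * (grad f ?p \<bullet> d)) \<le> c"
    by (simp add: algebra_simps)
  then show ?thesis by (simp add: algebra_simps)
qed

text \<open>A neighbourhood of \<open>wstar\<close> lies in the sublevel set, and at any point other than \<open>wstar\<close> the
  strong monotonicity of the gradient is compatible with its Lipschitz bound only if \<open>\<mu> \<le> \<Lambda>\<close>.\<close>
lemma mu_le_lipschitz_constant:
  assumes lip: "\<And>u v. f u \<le> c \<Longrightarrow> f v \<le> c \<Longrightarrow> norm (grad f u - grad f v) \<le> \<Lambda> * norm (u - v)"
    and "f wstar < c"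
  shows "\<mu> \<le> \<Lambda>"
proof -
  obtain e :: 'a where e: "e \<in> Basis" using nonempty_Basis by blast
  \<comment> \<open>The largest distance at which the quadratic upper bound still guarantees \<open>f \<le> c\<close>.\<close>
  define r where "r = sqrt (2 * (c - f wstar) / L)"
  have r: "0 < r" "r\<^sup>2 = 2 * (c - f wstar) / L"
    using assms(2) L_pos by (auto simp: r_def)
  define v where "v = wstar + r *\<^sub>R e"
  have nv: "norm (v - wstar) = r" using e r by (simp add: v_def)
  have "f v - f wstar \<le> c - f wstar" using growth_upper[of v] nv r L_pos by simp
  then have "norm (grad f v - grad f wstar) \<le> \<Lambda> * norm (v - wstar)"
    using assms(2) by (intro lip) auto
  then have gv: "norm (grad f v) \<le> \<Lambda> * r" by (simp add: grad_minimizer nv)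
  have "\<mu> * r\<^sup>2 \<le> grad f v \<bullet> (v - wstar)"
    using growth_lower[of v] strong_convexity[of v wstar] nv
    by (simp add: norm_minus_commute inner_diff_right)
  also have "\<dots> \<le> norm (grad f v) * norm (v - wstar)" by (rule norm_cauchy_schwarz)
  also have "\<dots> \<le> \<Lambda> * r\<^sup>2"
    using mult_right_mono[OF gv, of r] r(1) by (simp add: nv power2_eq_square mult.assoc)
  finally show ?thesis using r(1) by simp
qed

section \<open>Acceptance of short steps\<close>

text \<open>The gradient step cannot leave the sublevel set of \<open>y\<close>, although the Lipschitz bound is known
  only inside: \<open>f\<close> first decreases along the ray from \<open>y\<close>, so if the step ended above \<open>f y\<close>, the ray
  would cross the level \<open>f y\<close> before. Up to the crossing point the segment stays in the sublevel set
  by convexity, and there the descent lemma yields a value strictly below \<open>f y\<close>.\<close>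
lemma armijo_of_lipschitz_sublevel:
  assumes lip: "\<And>u v. f u \<le> f y \<Longrightarrow> f v \<le> f y \<Longrightarrow>
      norm (grad f u - grad f v) \<le> \<Lambda> * norm (u - v)"
    and "0 < \<Lambda>" "0 < \<eta>" "\<eta> \<le> 1 / \<Lambda>"
  shows "f (y - \<eta> *\<^sub>R grad f y) \<le> f y - \<eta> / 2 * (norm (grad f y))\<^sup>2"
proof (cases "grad f y = 0")
  case True
  then show ?thesis by simp
next
  case False
  let ?g = "grad f y"
  define h where "h t = f (y + t *\<^sub>R (- ?g))" for t
  have decrease: "h t \<le> h 0 - t / 2 * (norm ?g)\<^sup>2" if t: "0 < t" "t \<le> \<eta>" "h t \<le> h 0" for t
  proof -
    let ?d = "t *\<^sub>R (- ?g)"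
    have "f (y + ?d) \<le> f y + ?g \<bullet> ?d + \<Lambda> / 2 * (norm ?d)\<^sup>2"
    proof (rule descent_lemma)
      fix s :: real assume s: "0 \<le> s" "s \<le> 1"
      have "f (y + s *\<^sub>R ?d) \<le> f y"
        by (rule between_convex) (use s t in \<open>auto simp: h_def\<close>)
      then show "norm (grad f (y + s *\<^sub>R ?d) - grad f y) \<le> \<Lambda> * norm (s *\<^sub>R ?d)"
        using lip[of "y + s *\<^sub>R ?d" y] by simp
    qed
    also have "\<dots> = f y - t / 2 * (norm ?g)\<^sup>2 - t / 2 * (1 - \<Lambda> * t) * (norm ?g)\<^sup>2"
      unfolding power2_norm_eq_inner by (simp add: field_simps)
    also have "\<dots> \<le> f y - t / 2 * (norm ?g)\<^sup>2"
    proof -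
      have "\<Lambda> * t \<le> \<Lambda> * (1 / \<Lambda>)" using t assms by (intro mult_left_mono) auto
      then have "\<Lambda> * t \<le> 1" using assms by simp
      then show ?thesis using t by simp
    qed
    finally show ?thesis by (simp add: h_def)
  qed
  have deriv: "(h has_real_derivative grad f (y + t *\<^sub>R (- ?g)) \<bullet> (- ?g)) (at t)" for t
    unfolding h_def by (rule derivative_along_line)
  have "h \<eta> \<le> h 0"
  proof (rule ccontr)
    assume above: "\<not> h \<eta> \<le> h 0"
    have "(h has_real_derivative - (norm ?g)\<^sup>2) (at 0)"
      using deriv[of 0] by (simp add: power2_norm_eq_inner)
    moreover have "- (norm ?g)\<^sup>2 < 0" using False by simp
    ultimately obtain d where d: "0 < d" "\<And>t. 0 < t \<Longrightarrow> t < d \<Longrightarrow> h t < h 0"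
      using DERIV_neg_dec_right[of h "- (norm ?g)\<^sup>2" 0] by auto
    define t0 where "t0 = min d \<eta> / 2"
    have t0: "0 < t0" "t0 < d" "t0 \<le> \<eta>" using d(1) assms by (auto simp: t0_def)
    have "\<exists>t\<ge>t0. t \<le> \<eta> \<and> h t = h 0"
    proof (rule IVT')
      show "h t0 \<le> h 0" using d(2) t0 by force
      show "continuous_on {t0..\<eta>} h"
        using deriv by (meson DERIV_isCont continuous_at_imp_continuous_on)
    qed (use above t0 in auto)
    then obtain t where t: "t0 \<le> t" "t \<le> \<eta>" "h t = h 0" by blast
    then have "0 < t" using t0 by simp
    then have "h t \<le> h 0 - t / 2 * (norm ?g)\<^sup>2" using t by (intro decrease) auto
    moreover have "0 < t / 2 * (norm ?g)\<^sup>2" using \<open>0 < t\<close> False by simp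
    ultimately show False using t by simp
  qed
  then show ?thesis using decrease[of \<eta>] assms by (simp add: h_def)
qed

lemma two_step_armijo_of_lipschitz_sublevel:
  assumes "\<And>u v. f u \<le> c \<Longrightarrow> f v \<le> c \<Longrightarrow> norm (grad f u - grad f v) \<le> \<Lambda> * norm (u - v)"
    and "f (nag_y \<mu> \<eta> w z) \<le> c" and "0 < \<Lambda>" "0 < \<eta>" "\<eta> \<le> 1 / \<Lambda>"
  shows "two_step_armijo f \<mu> \<eta> w z"
proof -
  have "norm (grad f u - grad f v) \<le> \<Lambda> * norm (u - v)"
    if "f u \<le> f (nag_y \<mu> \<eta> w z)" "f v \<le> f (nag_y \<mu> \<eta> w z)" for u v
    using that assms(2) by (intro assms(1)) linarith+
  then show ?thesis
    unfolding two_step_armijo_def nag_w_def Let_def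
    using assms(3-) by (rule armijo_of_lipschitz_sublevel)
qed

section \<open>The potential\<close>

definition lyapunov :: "'a \<Rightarrow> 'a \<Rightarrow> real" where
  "lyapunov w z = f w - f wstar + \<mu> / 2 * (norm (z - wstar))\<^sup>2"

lemma lyapunov_bounds:
  "0 \<le> lyapunov w z" "f w - f wstar \<le> lyapunov w z"
  "\<mu> / 2 * (norm (z - wstar))\<^sup>2 \<le> lyapunov w z"
  using minimizer[of w] mu_pos by (auto simp: lyapunov_def)

text \<open>The weights of \<open>y\<close> are chosen for this relation: in the step inequality it makes all terms that
  are linear in the gradient cancel.\<close>
lemma nag_y_relation:
  assumes "0 < \<eta>"
  shows "w - nag_y \<mu> \<eta> w z = - sqrt (\<eta> * \<mu>) *\<^sub>R (z - nag_y \<mu> \<eta> w z)"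
proof -
  let ?s = "sqrt (\<eta> * \<mu>)"
  have s: "1 + ?s > 0" using assms mu_pos by (simp add: add_pos_pos)
  let ?r = "?s / (1 + ?s)"
  have "?r = ?s * (1 - ?r)" using s by (simp add: field_simps)
  then have "?r *\<^sub>R (z - w) = (?s * (1 - ?r)) *\<^sub>R (z - w)" by simp
  then show ?thesis by (simp add: nag_y_def algebra_simps)
qed

text \<open>Strong convexity at \<open>y\<close> is applied towards \<open>w\<close> with weight \<open>1 - s\<close> and towards \<open>wstar\<close> with
  weight \<open>s\<close>; the Armijo decrease then absorbs the squared gradient norm from expanding
  \<open>\<parallel>z' - wstar\<parallel>\<^sup>2\<close>. The remaining negative term, usually dropped, is what makes a step from the
  minimizer contract twice as fast.\<close>
lemma lyapunov_step:
  assumes "0 < \<eta>" "sqrt (\<eta> * \<mu>) \<le> 1" and armijo: "two_step_armijo f \<mu> \<eta> w z"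
  shows "lyapunov (nag_w f \<mu> \<eta> w z) (nag_z f \<mu> \<eta> w z)
    \<le> (1 - sqrt (\<eta> * \<mu>)) * (lyapunov w z
        - \<mu> / 2 * sqrt (\<eta> * \<mu>) * (1 + sqrt (\<eta> * \<mu>)) * (norm (z - nag_y \<mu> \<eta> w z))\<^sup>2)"
proof -
  define s where "s = sqrt (\<eta> * \<mu>)"
  define y where "y = nag_y \<mu> \<eta> w z"
  define g where "g = grad f y"
  define b where "b = z - y"
  define c where "c = wstar - y"
  have s: "0 < s" "s \<le> 1" "\<eta> = s\<^sup>2 / \<mu>" using assms mu_pos by (auto simp: s_def)
  have wy: "w - y = - s *\<^sub>R b"
    using nag_y_relation[OF assms(1), of w z] by (simp add: s_def y_def b_def)
  \<comment> \<open>All positions are taken relative to \<open>y\<close>: \<open>w\<close> becomes \<open>- s *\<^sub>R b\<close>, \<open>z\<close> becomes \<open>b\<close> and \<open>wstar\<close>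
    becomes \<open>c\<close>.\<close>
  have a1: "f (nag_w f \<mu> \<eta> w z) \<le> f y - s\<^sup>2 / (2 * \<mu>) * (g \<bullet> g)"
    using armijo s by (simp add: two_step_armijo_def y_def g_def power2_norm_eq_inner)
  have c1: "f y - s * (g \<bullet> b) + \<mu> / 2 * s\<^sup>2 * (b \<bullet> b) \<le> f w"
    using strong_convexity[of y w] unfolding wy power2_norm_eq_inner
    by (simp add: g_def power2_eq_square algebra_simps)
  have c2: "f y + g \<bullet> c + \<mu> / 2 * (c \<bullet> c) \<le> f wstar"
    using strong_convexity[of y wstar] by (simp add: g_def c_def power2_norm_eq_inner)
  have z': "nag_z f \<mu> \<eta> w z - wstar = (1 - s) *\<^sub>R b - c - (s / \<mu>) *\<^sub>R g"
    by (simp add: nag_z_def Let_def g_def b_def c_def algebra_simps flip: s_def y_def)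
  have n': "\<mu> / 2 * (norm (nag_z f \<mu> \<eta> w z - wstar))\<^sup>2
      = \<mu> / 2 * ((1 - s)\<^sup>2 * (b \<bullet> b) - 2 * (1 - s) * (b \<bullet> c) + c \<bullet> c)
        - s * ((1 - s) * (g \<bullet> b) - g \<bullet> c) + s\<^sup>2 / (2 * \<mu>) * (g \<bullet> g)"
    unfolding z' power2_norm_eq_inner using mu_pos
    by (simp add: inner_diff_left inner_diff_right inner_commute)
      (simp add: field_simps power2_eq_square)
  have "z - wstar = b - c" by (simp add: b_def c_def)
  then have n: "(norm (z - wstar))\<^sup>2 = b \<bullet> b - 2 * (b \<bullet> c) + c \<bullet> c"
    by (simp add: power2_norm_eq_inner inner_diff_left inner_diff_right inner_commute)
  have "(1 - s) * (f y - s * (g \<bullet> b) + \<mu> / 2 * s\<^sup>2 * (b \<bullet> b)) \<le> (1 - s) * f w"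
    using c1 s by (intro mult_left_mono) auto
  moreover have "s * (f y + g \<bullet> c + \<mu> / 2 * (c \<bullet> c)) \<le> s * f wstar"
    using c2 s by (intro mult_left_mono) auto
  ultimately show ?thesis
    unfolding lyapunov_def n' n b_def[symmetric] y_def[symmetric] s_def[symmetric]
    unfolding power2_norm_eq_inner using a1
    by (simp add: algebra_simps power2_eq_square add_divide_distrib diff_divide_distrib)
qed

text \<open>Strong convexity limits the decrease along the gradient step to
  \<open>(\<eta> - \<mu> * \<eta>\<^sup>2 / 2) * \<parallel>grad f y\<parallel>\<^sup>2\<close>. For \<open>\<eta> * \<mu> > 1\<close> this is less than the Armijo condition
  requires, unless the gradient is zero.\<close>
lemma long_step_hits_minimizer:
  assumes "0 < \<eta>" "1 < sqrt (\<eta> * \<mu>)" and armijo: "two_step_armijo f \<mu> \<eta> w z"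
  shows "nag_y \<mu> \<eta> w z = wstar"
proof -
  let ?y = "nag_y \<mu> \<eta> w z"
  let ?g = "grad f ?y"
  have q: "1 < \<eta> * \<mu>" using assms(2) by simp
  have "f ?y - \<eta> * (norm ?g)\<^sup>2 + \<mu> / 2 * \<eta>\<^sup>2 * (norm ?g)\<^sup>2 \<le> f (?y - \<eta> *\<^sub>R ?g)"
    using strong_convexity[of ?y "?y - \<eta> *\<^sub>R ?g"] unfolding power2_norm_eq_inner
    by (simp add: power2_eq_square algebra_simps)
  also have "\<dots> \<le> f ?y - \<eta> / 2 * (norm ?g)\<^sup>2"
    using armijo by (simp add: two_step_armijo_def nag_w_def Let_def)
  finally have "\<eta> / 2 * (\<eta> * \<mu> - 1) * (norm ?g)\<^sup>2 \<le> 0"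
    by (simp add: algebra_simps power2_eq_square)
  moreover have "0 < \<eta> / 2 * (\<eta> * \<mu> - 1)" using q assms(1) by simp
  ultimately have "(norm ?g)\<^sup>2 \<le> 0" by (meson mult_pos_pos not_le)
  then show ?thesis by (intro critical_point_unique) simp
qed

text \<open>When \<open>y = wstar\<close>, the point \<open>w\<close> is \<open>s\<close> times as far from \<open>wstar\<close> as \<open>z\<close> is, while the new \<open>z\<close> is
  only \<open>s - 1\<close> times as far. So quadratic growth of \<open>f\<close> at \<open>w\<close> already pays for the new potential.\<close>
lemma lyapunov_long_step:
  assumes "0 < \<eta>" "1 < sqrt (\<eta> * \<mu>)" and armijo: "two_step_armijo f \<mu> \<eta> w z"
  shows "nag_w f \<mu> \<eta> w z = wstar"
    and "lyapunov (nag_w f \<mu> \<eta> w z) (nag_z f \<mu> \<eta> w z) \<le> lyapunov w z"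
proof -
  define s where "s = sqrt (\<eta> * \<mu>)"
  have s: "1 < s" using assms by (simp add: s_def)
  have y: "nag_y \<mu> \<eta> w z = wstar" using long_step_hits_minimizer[OF assms] .
  show w': "nag_w f \<mu> \<eta> w z = wstar" by (simp add: nag_w_def y grad_minimizer)
  have z': "nag_z f \<mu> \<eta> w z - wstar = (1 - s) *\<^sub>R (z - wstar)"
    by (simp add: nag_z_def y grad_minimizer algebra_simps flip: s_def)
  have w: "w - wstar = - s *\<^sub>R (z - wstar)"
    using nag_y_relation[OF assms(1), of w z] by (simp add: y s_def)
  have "lyapunov (nag_w f \<mu> \<eta> w z) (nag_z f \<mu> \<eta> w z) = \<mu> / 2 * ((s - 1)\<^sup>2 * (norm (z - wstar))\<^sup>2)"
    by (simp add: lyapunov_def w' z' power_mult_distrib power2_commute)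
  also have "\<dots> \<le> \<mu> / 2 * (s\<^sup>2 * (norm (z - wstar))\<^sup>2)"
    using s mu_pos by (intro mult_left_mono mult_right_mono power_mono) auto
  also have "\<dots> = \<mu> / 2 * (norm (w - wstar))\<^sup>2" by (simp add: w power_mult_distrib)
  also have "\<dots> \<le> lyapunov w z" using growth_lower[of w] lyapunov_bounds(2)[of w z] by simp
  finally show "lyapunov (nag_w f \<mu> \<eta> w z) (nag_z f \<mu> \<eta> w z) \<le> lyapunov w z" .
qed

text \<open>With \<open>w = wstar\<close> one has \<open>z - wstar = (1 + s) *\<^sub>R (z - y)\<close>, so the extra term of
  \<open>lyapunov_step\<close> is a fixed fraction of the potential and improves the factor to
  \<open>(1 - s) / (1 + s)\<close>.\<close>
lemma lyapunov_step_from_minimizer: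
  assumes "0 < \<eta>" and armijo: "two_step_armijo f \<mu> \<eta> wstar z"
  shows "lyapunov (nag_w f \<mu> \<eta> wstar z) (nag_z f \<mu> \<eta> wstar z)
    \<le> exp (- (2 * sqrt (\<eta> * \<mu>))) * lyapunov wstar z"
proof (cases "sqrt (\<eta> * \<mu>) \<le> 1")
  case True
  define s where "s = sqrt (\<eta> * \<mu>)"
  define y where "y = nag_y \<mu> \<eta> wstar z"
  have s: "0 < s" using assms mu_pos by (simp add: s_def)
  have "wstar - y = - s *\<^sub>R (z - y)"
    using nag_y_relation[OF assms(1), of wstar z] by (simp add: s_def y_def)
  then have "z - wstar = (1 + s) *\<^sub>R (z - y)" by (simp add: algebra_simps)
  then have V: "lyapunov wstar z = (1 + s) * (\<mu> / 2 * (1 + s) * (norm (z - y))\<^sup>2)"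
    using s by (simp add: lyapunov_def power_mult_distrib power2_eq_square)
  have "lyapunov (nag_w f \<mu> \<eta> wstar z) (nag_z f \<mu> \<eta> wstar z)
      \<le> (1 - s) * (lyapunov wstar z - \<mu> / 2 * s * (1 + s) * (norm (z - y))\<^sup>2)"
    using lyapunov_step[OF assms(1) True armijo] by (simp add: s_def y_def)
  also have "\<dots> = (1 - s) * (\<mu> / 2 * (1 + s) * (norm (z - y))\<^sup>2)"
    unfolding V by (simp add: field_simps)
  also have "\<dots> = (1 - s) / (1 + s) * lyapunov wstar z" using s by (simp add: V)
  also have "\<dots> \<le> exp (- (2 * s)) * lyapunov wstar z"
    using s by (intro mult_right_mono exp_contraction_double lyapunov_bounds) auto
  finally show ?thesis by (simp add: s_def)
next
  case False
  then have y: "nag_y \<mu> \<eta> wstar z = wstar" using long_step_hits_minimizer assms by simp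
  then have "sqrt (\<eta> * \<mu>) *\<^sub>R (z - wstar) = 0"
    using nag_y_relation[OF assms(1), of wstar z] by simp
  then have "z = wstar" using assms mu_pos by simp
  then have "lyapunov wstar z = 0" by (simp add: lyapunov_def)
  then show ?thesis using lyapunov_long_step(2)[of \<eta> wstar z] assms False by simp
qed

section \<open>The invariant of the iteration\<close>

text \<open>\<open>K\<close> is the bound that uninterrupted contraction at rate \<open>\<rho>\<close> would give. The second alternative
  describes the state right after a long step: one factor \<open>exp (- \<rho>)\<close> is missing, but \<open>w\<close> is
  optimal.\<close>
definition envelope :: "real \<Rightarrow> real \<Rightarrow> 'a \<Rightarrow> 'a \<Rightarrow> bool" where
  "envelope \<rho> K w z \<longleftrightarrow> lyapunov w z \<le> K \<or> w = wstar \<and> lyapunov w z \<le> exp \<rho> * K"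

lemma envelope_gap:
  assumes "envelope \<rho> K w z" "0 \<le> K"
  shows "f w - f wstar \<le> K"
  using assms lyapunov_bounds(2)[of w z] by (auto simp: envelope_def)

lemma envelope_step:
  assumes "0 < \<eta>" and armijo: "two_step_armijo f \<mu> \<eta> w z"
    and rate: "\<rho> \<le> sqrt (\<eta> * \<mu>)" and K: "0 \<le> K" and env: "envelope \<rho> K w z"
  shows "envelope \<rho> (exp (- \<rho>) * K) (nag_w f \<mu> \<eta> w z) (nag_z f \<mu> \<eta> w z)"
proof -
  define s where "s = sqrt (\<eta> * \<mu>)"
  let ?V' = "lyapunov (nag_w f \<mu> \<eta> w z) (nag_z f \<mu> \<eta> w z)"
  have s: "0 < s" "\<rho> \<le> s" using assms mu_pos by (auto simp: s_def)
  show ?thesis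
  proof (cases "lyapunov w z \<le> K")
    case small: True
    show ?thesis
    proof (cases "s \<le> 1")
      case True
      have "?V' \<le> (1 - s) * (lyapunov w z
          - \<mu> / 2 * s * (1 + s) * (norm (z - nag_y \<mu> \<eta> w z))\<^sup>2)"
        using lyapunov_step[OF assms(1) _ armijo] True by (simp add: s_def)
      also have "\<dots> \<le> (1 - s) * lyapunov w z"
        using True s mu_pos by (intro mult_left_mono) auto
      also have "\<dots> \<le> exp (- \<rho>) * K"
      proof (intro mult_mono small lyapunov_bounds)
        show "1 - s \<le> exp (- \<rho>)" using exp_ge_add_one_self[of "- s"] s
          by (smt (verit) exp_le_cancel_iff)
      qed auto
      finally show ?thesis by (simp add: envelope_def)
    next
      case False
      then have "nag_w f \<mu> \<eta> w z = wstar" "?V' \<le> lyapunov w z"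
        using lyapunov_long_step[of \<eta> w z] assms by (auto simp: s_def)
      moreover have "exp \<rho> * (exp (- \<rho>) * K) = K" by (simp flip: mult.assoc exp_add)
      ultimately show ?thesis using small unfolding envelope_def by linarith
    qed
  next
    case False
    then have w: "w = wstar" and V: "lyapunov wstar z \<le> exp \<rho> * K"
      using env by (auto simp: envelope_def)
    have "?V' \<le> exp (- (2 * s)) * lyapunov wstar z"
      using lyapunov_step_from_minimizer[OF assms(1), of z] armijo by (simp add: w s_def)
    also have "\<dots> \<le> exp (- (2 * \<rho>)) * (exp \<rho> * K)"
      using s V by (intro mult_mono lyapunov_bounds) auto
    also have "\<dots> = exp (- \<rho>) * K" by (simp flip: mult.assoc exp_add)
    finally show ?thesis by (simp add: envelope_def)
  qed
qed

lemma nag_envelope_step: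
  assumes acc: "\<And>\<eta>. 0 < \<eta> \<Longrightarrow> \<eta> \<le> 1 / \<Lambda> \<Longrightarrow>
      two_step_armijo f \<mu> \<eta> (fst (nag f \<mu> \<eta>max w0 t)) (snd (nag f \<mu> \<eta>max w0 t))"
    and "0 < \<Lambda>" "1 / \<Lambda> \<le> \<eta>max" "0 \<le> K"
    and env: "envelope (sqrt (\<mu> / (2 * \<Lambda>))) K
      (fst (nag f \<mu> \<eta>max w0 t)) (snd (nag f \<mu> \<eta>max w0 t))"
  shows "envelope (sqrt (\<mu> / (2 * \<Lambda>))) (exp (- sqrt (\<mu> / (2 * \<Lambda>))) * K)
    (fst (nag f \<mu> \<eta>max w0 (Suc t))) (snd (nag f \<mu> \<eta>max w0 (Suc t)))"
proof -
  obtain w z where wz: "nag f \<mu> \<eta>max w0 t = (w, z)" by force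
  let ?\<eta> = "backtracking_step f \<mu> \<eta>max w z"
  have armijo: "two_step_armijo f \<mu> ?\<eta> w z" and lower: "1 / (2 * \<Lambda>) \<le> ?\<eta>"
    using backtracking_accepts[of \<Lambda> f \<mu> w z \<eta>max] acc assms wz by auto
  have pos: "0 < ?\<eta>" by (rule less_le_trans[OF _ lower]) (use assms in auto)
  have "1 / (2 * \<Lambda>) * \<mu> \<le> ?\<eta> * \<mu>" using lower mu_pos by (intro mult_right_mono) auto
  then have "sqrt (\<mu> / (2 * \<Lambda>)) \<le> sqrt (?\<eta> * \<mu>)" by simp
  from envelope_step[OF pos armijo this \<open>0 \<le> K\<close>] env show ?thesis
    by (simp add: wz Let_def)
qed

section \<open>The two phases\<close>

lemma global_phase:
  assumes "1 / L \<le> \<eta>max"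
  shows "envelope (sqrt (\<mu> / (2 * L))) (exp (- (real t * sqrt (\<mu> / (2 * L)))) * lyapunov w0 w0)
    (fst (nag f \<mu> \<eta>max w0 t)) (snd (nag f \<mu> \<eta>max w0 t))"
proof (induction t)
  case 0
  show ?case by (simp add: envelope_def)
next
  case (Suc t)
  have "envelope (sqrt (\<mu> / (2 * L)))
     (exp (- sqrt (\<mu> / (2 * L))) * (exp (- (real t * sqrt (\<mu> / (2 * L)))) * lyapunov w0 w0))
    (fst (nag f \<mu> \<eta>max w0 (Suc t))) (snd (nag f \<mu> \<eta>max w0 (Suc t)))"
  proof (rule nag_envelope_step[OF _ L_pos assms _ Suc])
    fix \<eta> :: real assume "0 < \<eta>" "\<eta> \<le> 1 / L"
    then show "two_step_armijo f \<mu> \<eta> (fst (nag f \<mu> \<eta>max w0 t)) (snd (nag f \<mu> \<eta>max w0 t))"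
      using L_pos by (intro two_step_armijo_of_lipschitz_sublevel[OF lipschitz order_refl])
  qed (simp add: lyapunov_bounds)
  then show ?case by (simp add: algebra_simps flip: exp_add mult.assoc)
qed

text \<open>If \<open>V \<le> \<mu> * \<delta> / L\<close>, then \<open>\<parallel>z - wstar\<parallel>\<^sup>2 \<le> 2 * \<delta> / L\<close> and \<open>L\<close>-smoothness puts \<open>z\<close> into the
  sublevel set; \<open>w\<close> lies there since \<open>\<mu> \<le> L\<close>, and \<open>y\<close> lies between them. After a long step the
  potential, and with it the bound for \<open>z\<close>, may be larger by a factor \<open>exp \<rho> < 4\<close>, but then
  \<open>w = wstar\<close> and \<open>y\<close> is at most half as far from \<open>wstar\<close> as \<open>z\<close>, which gains the factor
  \<open>4\<close> back.\<close>
lemma nag_y_in_sublevel: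
  assumes env: "envelope \<rho> (\<mu> * \<delta> / L) w z" and "\<rho> \<le> 1" "0 < \<delta>" "\<mu> \<le> L"
    and "0 < \<eta>" "\<eta> * \<mu> \<le> 1"
  shows "f (nag_y \<mu> \<eta> w z) \<le> f wstar + \<delta>"
proof -
  let ?s = "sqrt (\<eta> * \<mu>)"
  let ?r = "?s / (1 + ?s)"
  have s: "0 < ?s" "?s \<le> 1" using assms mu_pos by auto
  have ratio: "0 \<le> x / (1 + x)" "x / (1 + x) \<le> 1 / 2" if "0 < x" "x \<le> 1" for x :: real
    using that by (simp_all add: field_simps)
  note r = ratio[OF s]
  then have "?r \<le> 1" by linarith
  have z: "L / 2 * (norm (z - wstar))\<^sup>2 \<le> L / \<mu> * lyapunov w z"
    using mult_left_mono[OF lyapunov_bounds(3)[where w=w and z=z], of "L / \<mu>"] mu_pos L_pos by simp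
  show ?thesis
  proof (cases "lyapunov w z \<le> \<mu> * \<delta> / L")
    case True
    have "f (w + ?r *\<^sub>R (z - w)) \<le> f wstar + \<delta>"
    proof (rule between_convex)
      have "\<mu> * \<delta> / L \<le> \<delta>" using assms L_pos by (simp add: field_simps)
      then show "f w \<le> f wstar + \<delta>" using lyapunov_bounds(2)[of w z] True by linarith
      have "L / \<mu> * lyapunov w z \<le> L / \<mu> * (\<mu> * \<delta> / L)"
        using True mu_pos L_pos by (intro mult_left_mono) auto
      also have "\<dots> = \<delta>" using mu_pos L_pos by simp
      finally have "f z \<le> f wstar + \<delta>" using growth_upper[of z] z by linarith
      then show "f (w + (z - w)) \<le> f wstar + \<delta>" by simp
    qed (fact r(1) \<open>?r \<le> 1\<close>)+
    then show ?thesis by (simp add: nag_y_def)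
  next
    case False
    then have w: "w = wstar" and V: "lyapunov w z \<le> exp \<rho> * (\<mu> * \<delta> / L)"
      using env by (auto simp: envelope_def)
    have "exp \<rho> \<le> 4" using exp_le assms(2) by (smt (verit) exp_le_cancel_iff)
    then have "exp \<rho> * (\<mu> * \<delta> / L) \<le> 4 * (\<mu> * \<delta> / L)"
      using assms mu_pos L_pos by (intro mult_right_mono) auto
    with V have "L / \<mu> * lyapunov w z \<le> L / \<mu> * (4 * (\<mu> * \<delta> / L))"
      using mu_pos L_pos by (intro mult_left_mono) auto
    also have "\<dots> = 4 * \<delta>" using mu_pos L_pos by simp
    finally have far: "L / 2 * (norm (z - wstar))\<^sup>2 \<le> 4 * \<delta>" using z by linarith
    have "nag_y \<mu> \<eta> w z - wstar = ?r *\<^sub>R (z - wstar)" by (simp add: nag_y_def w)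
    then have "(norm (nag_y \<mu> \<eta> w z - wstar))\<^sup>2 = ?r\<^sup>2 * (norm (z - wstar))\<^sup>2"
      by (simp only: norm_scaleR power_mult_distrib power2_abs)
    with growth_upper[of "nag_y \<mu> \<eta> w z"]
    have "f (nag_y \<mu> \<eta> w z) - f wstar \<le> ?r\<^sup>2 * (L / 2 * (norm (z - wstar))\<^sup>2)"
      by (simp only: mult.left_commute)
    also have "\<dots> \<le> (1 / 2)\<^sup>2 * (4 * \<delta>)"
      by (rule mult_mono[OF power_mono[OF r(2,1)] far]) (use L_pos in auto)
    finally show ?thesis by (simp add: power2_eq_square)
  qed
qed

lemma local_phase:
  assumes lip: "\<And>u v. f u \<le> f wstar + \<delta> \<Longrightarrow> f v \<le> f wstar + \<delta> \<Longrightarrow>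
      norm (grad f u - grad f v) \<le> Ls * norm (u - v)"
    and "0 < \<delta>" "0 < Ls" "Ls \<le> L" "1 / Ls \<le> \<eta>max"
    and start: "envelope (sqrt (\<mu> / (2 * Ls))) (\<mu> * \<delta> / L)
      (fst (nag f \<mu> \<eta>max w0 t)) (snd (nag f \<mu> \<eta>max w0 t))"
  shows "envelope (sqrt (\<mu> / (2 * Ls))) (exp (- (real n * sqrt (\<mu> / (2 * Ls)))) * (\<mu> * \<delta> / L))
    (fst (nag f \<mu> \<eta>max w0 (t + n))) (snd (nag f \<mu> \<eta>max w0 (t + n)))"
proof (induction n)
  case 0
  then show ?case using start by simp
next
  case (Suc n)
  let ?\<rho> = "sqrt (\<mu> / (2 * Ls))" and ?w = "fst (nag f \<mu> \<eta>max w0 (t + n))"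
    and ?z = "snd (nag f \<mu> \<eta>max w0 (t + n))"
  have muLs: "\<mu> \<le> Ls" using mu_le_lipschitz_constant[of "f wstar + \<delta>" Ls] lip assms(2) by auto
  have \<rho>: "0 \<le> ?\<rho>" "?\<rho> \<le> 1" using muLs mu_pos by (auto simp: field_simps)
  have M: "0 \<le> \<mu> * \<delta> / L" using mu_pos L_pos assms by simp
  have "exp (- (real n * ?\<rho>)) * (\<mu> * \<delta> / L) \<le> 1 * (\<mu> * \<delta> / L)"
    using \<rho> M by (intro mult_right_mono) auto
  then have "envelope ?\<rho> (\<mu> * \<delta> / L) ?w ?z"
    using Suc unfolding envelope_def by (smt (verit) exp_gt_zero mult_left_mono)
  then have y: "f (nag_y \<mu> \<eta> ?w ?z) \<le> f wstar + \<delta>" if "0 < \<eta>" "\<eta> * \<mu> \<le> 1" for \<eta>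
    using nag_y_in_sublevel[of ?\<rho> \<delta> ?w ?z \<eta>] \<rho> assms muLs that by auto
  have "envelope ?\<rho> (exp (- ?\<rho>) * (exp (- (real n * ?\<rho>)) * (\<mu> * \<delta> / L)))
    (fst (nag f \<mu> \<eta>max w0 (Suc (t + n)))) (snd (nag f \<mu> \<eta>max w0 (Suc (t + n))))"
  proof (rule nag_envelope_step[OF _ assms(3,5) _ Suc])
    fix \<eta> :: real assume \<eta>: "0 < \<eta>" "\<eta> \<le> 1 / Ls"
    have "\<eta> * \<mu> \<le> 1 / Ls * Ls" using \<eta> muLs mu_pos assms by (intro mult_mono) auto
    then have "\<eta> * \<mu> \<le> 1" using assms by simp
    then show "two_step_armijo f \<mu> \<eta> ?w ?z"
      using y \<eta> assms by (intro two_step_armijo_of_lipschitz_sublevel[OF lip]) auto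
  qed (use M in \<open>intro mult_nonneg_nonneg, auto\<close>)
  then show ?case by (simp add: algebra_simps flip: exp_add mult.assoc)
qed

end

section \<open>The iteration bound\<close>

theorem theorem9:
  fixes f :: "real ^ 'n \<Rightarrow> real" and w0 wstar :: "real ^ 'n"
    and L Ls \<delta> \<mu> \<epsilon> \<eta>max \<Delta>0 :: real and T :: nat
  assumes differentiable: "\<And>u. f differentiable (at u)"
    and constants: "L > 0" "Ls > 0" "Ls \<le> L" "\<delta> > 0"
    and smooth: "glocally_smooth L Ls \<delta> f"
    and "\<mu> > 0"
    and convex: "strongly_convex \<mu> f"
    and minimizer: "\<And>u. f wstar \<le> f u"
    and gap: "\<Delta>0 = f w0 - f wstar"
    and accuracy: "\<Delta>0 > \<delta>" "\<delta> > \<epsilon>" "\<epsilon> > 0"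
    and initial_step: "\<eta>max \<ge> 1 / Ls"
    and iterations:
      "real T \<ge> sqrt (2 * L / \<mu>) * ln (L / \<mu> * ((\<Delta>0 + \<mu> / 2 * (norm (w0 - wstar))\<^sup>2) / \<delta>))
              + sqrt (2 * Ls / \<mu>) * ln (\<mu> / L * (\<delta> / \<epsilon>)) + 1"
  shows "f (fst (nag f \<mu> \<eta>max w0 T)) - f wstar \<le> \<epsilon>"
proof -
  interpret smooth_strongly_convex f L \<mu> wstar
    by unfold_locales (use assms in \<open>auto simp: glocally_smooth_def\<close>)
  have inf: "Inf (range f) = f wstar"
    by (rule cInf_eq_minimum) (use minimizer in auto)
  have lip: "norm (grad f u - grad f v) \<le> Ls * norm (u - v)"
    if "f u \<le> f wstar + \<delta>" "f v \<le> f wstar + \<delta>" for u v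
    using smooth that by (auto simp: glocally_smooth_def inf)
  define \<rho> where "\<rho> = sqrt (\<mu> / (2 * L))"
  define \<rho>s where "\<rho>s = sqrt (\<mu> / (2 * Ls))"
  define V where "V = lyapunov w0 w0"
  define M where "M = \<mu> * \<delta> / L"
  define a where "a = 1 / \<rho> * ln (V / M)"
  define b where "b = 1 / \<rho>s * ln (M / \<epsilon>)"
  have pos: "0 < \<rho>" "0 < \<rho>s" "0 < M" "0 < V"
    using constants \<open>\<mu> > 0\<close> accuracy gap
    by (auto simp: \<rho>_def \<rho>s_def M_def V_def lyapunov_def intro!: add_pos_nonneg)
  have T: "a + b + 1 \<le> real T"
  proof -
    have "sqrt (2 * L / \<mu>) = 1 / \<rho>" "sqrt (2 * Ls / \<mu>) = 1 / \<rho>s"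
      by (simp_all add: \<rho>_def \<rho>s_def real_sqrt_divide)
    moreover have "L / \<mu> * ((\<Delta>0 + \<mu> / 2 * (norm (w0 - wstar))\<^sup>2) / \<delta>) = V / M"
      by (simp add: V_def M_def lyapunov_def gap)
    moreover have "\<mu> / L * (\<delta> / \<epsilon>) = M / \<epsilon>" by (simp add: M_def)
    ultimately show ?thesis using iterations by (simp only: a_def b_def)
  qed
  have \<rho>_le: "\<rho> \<le> \<rho>s"
    unfolding \<rho>_def \<rho>s_def using constants \<open>\<mu> > 0\<close>
    by (intro real_sqrt_le_mono divide_left_mono) auto
  have "1 / L \<le> 1 / Ls" using constants by (intro divide_left_mono) auto
  then have \<eta>max: "1 / L \<le> \<eta>max" using initial_step by linarith
  note phase1 = global_phase[OF \<eta>max, where ?w0.0 = w0, folded \<rho>_def V_def]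
  \<comment> \<open>\<open>M\<close> is the potential at which the second phase may begin; if it does not exceed \<open>\<epsilon>\<close>, the second
    summand \<open>b\<close> of the bound is nonpositive and the first phase alone has to reach \<open>\<epsilon>\<close>. It does,
    since replacing \<open>\<rho>s\<close> by the smaller \<open>\<rho>\<close> in \<open>b\<close> lowers the required number of steps.\<close>
  show ?thesis
  proof (cases "M \<le> \<epsilon>")
    case True
    have "ln (M / \<epsilon>) \<le> 0" using True pos accuracy by simp
    then have "1 / \<rho> * ln (M / \<epsilon>) \<le> b"
      unfolding b_def using pos \<rho>_le by (intro mult_right_mono_neg divide_left_mono) auto
    moreover have "1 / \<rho> * ln (V / \<epsilon>) = a + 1 / \<rho> * ln (M / \<epsilon>)"
      using pos accuracy by (simp add: a_def ln_div field_simps)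
    ultimately have "exp (- (real T * \<rho>)) * V \<le> \<epsilon>"
      using T pos accuracy by (intro exp_decay_le) auto
    moreover have "f (fst (nag f \<mu> \<eta>max w0 T)) - f wstar \<le> exp (- (real T * \<rho>)) * V"
      by (rule envelope_gap[OF phase1]) (use pos in auto)
    ultimately show ?thesis by simp
  next
    case False
    define T1 where "T1 = nat \<lceil>a\<rceil>"
    have "\<mu> \<le> L"
      using mu_le_lipschitz_constant[of "f wstar + \<delta>" L] lipschitz constants by auto
    then have "M \<le> \<delta>" using constants by (simp add: M_def field_simps)
    moreover have "\<delta> \<le> V" unfolding V_def using accuracy gap lyapunov_bounds(2)[of w0 w0] by linarith
    ultimately have "0 \<le> a" using pos by (simp add: a_def)
    moreover have "0 < b" using False pos accuracy by (simp add: b_def)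
    ultimately have T1: "a \<le> real T1" "real T1 \<le> a + 1" "T1 \<le> T" "b \<le> real (T - T1)"
      using T unfolding T1_def by linarith+
    have "exp (- (real T1 * \<rho>)) * V \<le> M" using T1 pos by (intro exp_decay_le) (auto simp: a_def)
    \<comment> \<open>The first phase may end right after a long step, lacking a factor \<open>exp (- \<rho>)\<close>. The second phase
      tolerates a missing factor \<open>exp (- \<rho>s)\<close>, which is no larger, so nothing is lost.\<close>
    then have "envelope \<rho>s M (fst (nag f \<mu> \<eta>max w0 T1)) (snd (nag f \<mu> \<eta>max w0 T1))"
      using phase1[of T1] \<rho>_le pos unfolding envelope_def
      by (smt (verit) exp_le_cancel_iff exp_gt_zero mult_mono mult_nonneg_nonneg)
    from local_phase[OF lip constants(4,2,3) initial_step this[unfolded \<rho>s_def M_def],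
        where n = "T - T1", folded \<rho>s_def M_def]
    have "envelope \<rho>s (exp (- (real (T - T1) * \<rho>s)) * M)
        (fst (nag f \<mu> \<eta>max w0 T)) (snd (nag f \<mu> \<eta>max w0 T))"
      using T1 by simp
    then have "f (fst (nag f \<mu> \<eta>max w0 T)) - f wstar \<le> exp (- (real (T - T1) * \<rho>s)) * M"
      by (rule envelope_gap) (use pos in auto)
    also have "\<dots> \<le> \<epsilon>" using T1 pos accuracy by (intro exp_decay_le) (auto simp: b_def)
    finally show ?thesis .
  qed
qed

end
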